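(* For each integer $k \in \mathbb{Z}\setminus\{-1,0,1\}$ there are infinitely many pairs of integers $(A,B)$ such that $\gcd(A,B)$ is square-free and the Diophantine equation $x^2 = A k^{n} + B$ has at least four solutions $(x,n)$ in non-negative integers. *)

theory Defs
  imports "HOL-Computational_Algebra.Squarefree"
begin

definition solutions :: "int \<Rightarrow> int \<Rightarrow> int \<Rightarrow> (nat \<times> nat) set" where
  "solutions k A B = {(x, n). (int x)\<^sup>2 = A * k ^ n + B}"

(* Stated via a four-element subset because the solution set may be infinite
   (e.g. A = k, B = 0 with k squarefree), and card of an infinite set is 0. *)
definition at_least_four_solutions :: "int \<Rightarrow> int \<Rightarrow> int \<Rightarrow> bool" where
  "at_least_four_solutions k A B \<longleftrightarrow> (\<exists>S. S \<subseteq> solutions k A B \<and> card S = 4)"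

end

(* The four conditions A k^n + B = square, n = 0, 1, 2, 3, cut out a genus one curve in P^3.
   Starting from the trivial point A = 0 and following the group law (tripling) one obtains
   a nontrivial point whose coordinates are polynomials in k, with A and B nonzero.
   Replacing B by B k^(2t) shifts the exponents by 2t and gives pairwise distinct ratios B/A;
   dividing by the largest square factor of gcd(A, B) makes the gcd squarefree and keeps the ratio. *)
theory Submission
  imports Defs
begin

text \<open>Writing \<open>w i\<close> for the four bases, each difference
  \<open>w (i+1) ^ 2 - w i ^ 2\<close> factors as difference times sum into
  \<open>A * k ^ i * (k - 1)\<close>; for \<open>i = 0\<close> the factors are
  \<open>4 * (k + 1)\<close> and \<open>2 * (k - 1) * (k ^ 2 + 1)\<close>.\<close>

lemma squares_at_consecutive_exponents:
  fixes k :: int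
  defines "A \<equiv> 8 * (k + 1) * (k\<^sup>2 + 1)"
  defines "B \<equiv> (k ^ 3 - k\<^sup>2 - k - 3)\<^sup>2 - A"
  shows "(k ^ 3 - k\<^sup>2 - k - 3)\<^sup>2 = A * k ^ 0 + B"
    and "(k ^ 3 - k\<^sup>2 + 3 * k + 1)\<^sup>2 = A * k ^ 1 + B"
    and "(k ^ 3 + 3 * k\<^sup>2 - k + 1)\<^sup>2 = A * k ^ 2 + B"
    and "(3 * k ^ 3 + k\<^sup>2 + k - 1)\<^sup>2 = A * k ^ 3 + B"
  unfolding A_def B_def by algebra+

text \<open>The exponents alone keep the four pairs apart, so the \<open>w i\<close> may be negative
  or coincide.\<close>

lemma at_least_four_solutionsI:
  assumes "\<And>i. i < 4 \<Longrightarrow> (w i)\<^sup>2 = A * k ^ (n + i) + B"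
  shows "at_least_four_solutions k A B"
proof -
  let ?f = "\<lambda>i. (nat \<bar>w i\<bar>, n + i)"
  have "?f ` {..<4} \<subseteq> solutions k A B"
    using assms by (auto simp: solutions_def)
  moreover have "card (?f ` {..<4}) = 4"
    by (subst card_image) (auto intro: inj_onI)
  ultimately show ?thesis
    unfolding at_least_four_solutions_def by blast
qed

text \<open>Dividing by the square part of the gcd leaves its squarefree part. The last conclusion
  keeps the ratio \<open>B / A\<close>, by which the resulting pairs are later told apart.\<close>

lemma remove_square_factor:
  fixes A B k :: int
  assumes sol: "\<And>i. i < 4 \<Longrightarrow> (w i)\<^sup>2 = A * k ^ (n + i) + B" and "A \<noteq> 0"
  obtains A' B' where "squarefree (gcd A' B')" "at_least_four_solutions k A' B'"
    "A' \<noteq> 0" "A' * B = B' * A"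
proof -
  define m where "m = square_part (gcd A B)"
  define s where "s = squarefree_part (gcd A B)"
  have nz: "gcd A B \<noteq> 0"
    using \<open>A \<noteq> 0\<close> by simp
  have dec: "gcd A B = s * m\<^sup>2"
    unfolding m_def s_def by (rule squarefree_decompose)
  have "m \<noteq> 0"
    using dec nz by auto
  have "m\<^sup>2 dvd A" "m\<^sup>2 dvd B"
    using dec by (metis dvd_triv_right gcd_greatest_iff)+
  then obtain A' B' where A': "A = m\<^sup>2 * A'" and B': "B = m\<^sup>2 * B'"
    by (auto elim!: dvdE)
  have "m\<^sup>2 * gcd A' B' = m\<^sup>2 * s"
    using dec gcd_mult_distrib_int[of "m\<^sup>2" A' B'] by (simp add: A' B' mult.commute)
  hence "gcd A' B' = s"
    using \<open>m \<noteq> 0\<close> by simp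
  hence sf: "squarefree (gcd A' B')"
    using nz by (simp add: s_def)
  \<comment> \<open>The quotient is again a square, since \<open>m ^ 2 dvd w i ^ 2\<close> forces
    \<open>m dvd w i\<close>.\<close>
  have "(w i div m)\<^sup>2 = A' * k ^ (n + i) + B'" if "i < 4" for i
  proof -
    have eq: "(w i)\<^sup>2 = m\<^sup>2 * (A' * k ^ (n + i) + B')"
      using sol[OF that] by (simp add: A' B' algebra_simps)
    hence "m\<^sup>2 dvd (w i)\<^sup>2"
      by simp
    hence "m dvd w i"
      by simp
    then obtain v where "w i = m * v" ..
    thus ?thesis
      using eq \<open>m \<noteq> 0\<close> by (simp add: power_mult_distrib)
  qed
  hence "at_least_four_solutions k A' B'"
    by (rule at_least_four_solutionsI)
  with sf show thesis
    using \<open>A \<noteq> 0\<close> by (intro that[of A' B']) (auto simp: A' B')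
qed

theorem theorem2p1:
  fixes k :: int
  assumes "k \<notin> {-1, 0, 1}"
  shows "infinite {(A :: int, B :: int). squarefree (gcd A B) \<and> at_least_four_solutions k A B}"
    (is "infinite ?S")
proof -
  define A where "A = 8 * (k + 1) * (k\<^sup>2 + 1)"
  define B where "B = (k ^ 3 - k\<^sup>2 - k - 3)\<^sup>2 - A"
  define w where "w = (!) [k ^ 3 - k\<^sup>2 - k - 3, k ^ 3 - k\<^sup>2 + 3 * k + 1,
    k ^ 3 + 3 * k\<^sup>2 - k + 1, 3 * k ^ 3 + k\<^sup>2 + k - 1]"
  have w: "(w i)\<^sup>2 = A * k ^ i + B" if "i < 4" for i
  proof -
    have "i \<in> {0, 1, 2, 3}"
      using that by auto
    thus ?thesis
      using squares_at_consecutive_exponents[of k]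
      by (auto simp: w_def A_def B_def)
  qed
  have "k\<^sup>2 + 1 > 0"
    by (simp add: add_nonneg_pos)
  hence "k\<^sup>2 + 1 \<noteq> 0"
    by linarith
  hence "A \<noteq> 0"
    using assms by (simp add: A_def add_eq_0_iff2)
  \<comment> \<open>As a polynomial in \<open>k\<close>, \<open>B\<close> has constant term 9 - 8 =
    1, so \<open>B = 0\<close> would make \<open>k\<close> a unit.\<close>
  have "B = 1 + k * (k ^ 5 - 2 * k ^ 4 - k ^ 3 - 12 * k\<^sup>2 - k - 2)"
    unfolding A_def B_def by algebra
  hence "k dvd B - 1"
    by simp
  moreover have "\<not> k dvd - 1"
    using assms by (auto simp: zdvd1_eq)
  ultimately have "B \<noteq> 0"
    by auto
  have "\<exists>P. P \<in> ?S \<and> fst P \<noteq> 0 \<and> fst P * (B * k ^ (2 * t)) = snd P * A" for t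
  proof -
    \<comment> \<open>The equation is multiplied by the square \<open>k ^ (2 * t)\<close>, which the
      exponent absorbs in the term with \<open>A\<close>.\<close>
    have "(k ^ t * w i)\<^sup>2 = A * k ^ (2 * t + i) + B * k ^ (2 * t)" if "i < 4" for i
    proof -
      have "(k ^ t * w i)\<^sup>2 = k ^ (2 * t) * (w i)\<^sup>2"
        by (simp add: power_mult_distrib power_even_eq)
      thus ?thesis
        using w[OF that] by (simp add: power_add algebra_simps)
    qed
    from remove_square_factor[OF this \<open>A \<noteq> 0\<close>]
    obtain A' B' where "(A', B') \<in> ?S" "A' \<noteq> 0" "A' * (B * k ^ (2 * t)) = B' * A"
      by blast
    thus ?thesis
      by (intro exI[of _ "(A', B')"]) auto
  qed
  hence "\<exists>P. \<forall>t. P t \<in> ?S \<and> fst (P t) \<noteq> 0 \<and> fst (P t) * (B * k ^ (2 * t)) = snd (P t) * A"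
    by (intro choice allI)
  then obtain P where "\<forall>t. P t \<in> ?S \<and> fst (P t) \<noteq> 0 \<and> fst (P t) * (B * k ^ (2 * t)) = snd (P t) * A"
    by (rule exE)
  hence P: "P t \<in> ?S" "fst (P t) \<noteq> 0" "fst (P t) * (B * k ^ (2 * t)) = snd (P t) * A" for t
    by (simp_all only: simp_thms)
  have "inj P"
  proof (rule injI)
    fix t u assume "P t = P u"
    \<comment> \<open>Equal pairs have equal ratios, and these are
      \<open>B * k ^ (2 * t) / A\<close> and \<open>B * k ^ (2 * u) / A\<close>.\<close>
    hence "fst (P u) * (B * k ^ (2 * t)) = fst (P u) * (B * k ^ (2 * u))"
      using P(3)[of t] P(3)[of u] by metis
    hence "k ^ (2 * t) = k ^ (2 * u)"
      using P(2)[of u] \<open>B \<noteq> 0\<close> by simp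
    \<comment> \<open>Since \<open>k\<close> may be negative, exponents are compared over a base
      greater than 1.\<close>
    hence "\<bar>k\<bar> ^ (2 * t) = \<bar>k\<bar> ^ (2 * u)"
      by (metis power_abs)
    moreover have "\<bar>k\<bar> > 1"
      using assms by auto
    ultimately show "t = u"
      using power_inject_exp[of "\<bar>k\<bar>"] by simp
  qed
  hence "infinite (range P)"
    using finite_imageD[of P UNIV] by auto
  moreover have "range P \<subseteq> ?S"
    by (intro image_subsetI P(1))
  ultimately show ?thesis
    by (rule infinite_super[rotated])
qed

end
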